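(* Let $\mathbb{F}_q$ be a finite field, let $d$ and $k$ be positive integers with $d<k$, let $f=T^{k+d}+f_{d-1}T^{k+d-1}+\cdots+f_0T^k$ be a polynomial of $\mathbb{F}_q[T]$ and let $H_f\in\mathbb{F}_q[X_1,\ldots,X_{k+1}]$ be the polynomial associated to $f$. Then $$H_f=H_d+f_{d-1}H_{d-1}+\cdots+f_1H_1+f_0.$$
   Context: Put $Q=(T-X_1)\cdots(T-X_{k+1})\in\mathbb{F}_q[X_1,\ldots,X_{k+1}][T]$. For $f=T^{k+d}+f_{d-1}T^{k+d-1}+\cdots+f_0T^k\in\mathbb{F}_q[T]$, let $R_f\in\mathbb{F}_q[X_1,\ldots,X_{k+1}][T]$ be the unique polynomial of degree at most $k$ in $T$ with $f\equiv R_f\bmod Q$. The polynomial $H_f$ associated to $f$ is the coefficient of $T^k$ in $R_f$. For $1\le j\le d$, $H_j$ denotes the polynomial associated in this way to the monomial $T^{k+j}$. *)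

theory Defs
  imports
    "HOL-Library.Poly_Mapping"
    "HOL-Computational_Algebra.Polynomial"
begin

text \<open>
  Multivariate polynomials over \<open>'a\<close> in variables indexed by \<^typ>\<open>nat\<close>: finitely supported
  functions from exponent vectors to coefficients, with the convolution product.
  The subring of polynomials in the first \<open>n\<close> variables \<open>X 1, \<dots>, X n\<close> is \<open>mpolys n\<close> below.
\<close>

type_synonym 'a mpol = "(nat \<Rightarrow>\<^sub>0 nat) \<Rightarrow>\<^sub>0 'a"

definition X :: "nat \<Rightarrow> 'a::comm_ring_1 mpol" where
  "X i = Poly_Mapping.single (Poly_Mapping.single i 1) 1"

definition C :: "'a::comm_ring_1 \<Rightarrow> 'a mpol" where
  "C a = Poly_Mapping.single 0 a"

definition mpolys :: "nat \<Rightarrow> 'a::comm_ring_1 mpol set" where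
  "mpolys n = {p. \<forall>m \<in> Poly_Mapping.keys p. Poly_Mapping.keys m \<subseteq> {1..n}}"

text \<open>The indeterminate of an \<open>'a mpol poly\<close> plays the role of \<open>T\<close>.\<close>

definition mpolys_T :: "nat \<Rightarrow> 'a::comm_ring_1 mpol poly set" where
  "mpolys_T n = {P. \<forall>i. coeff P i \<in> mpolys n}"

definition Q :: "nat \<Rightarrow> 'a::comm_ring_1 mpol poly" where
  "Q k = (\<Prod>i = 1..k + 1. [:- X i, 1:])"

text \<open>
  \<open>is_rem k f R\<close>: \<open>f\<close> is congruent to \<open>R\<close> modulo \<open>Q\<close> and \<open>R\<close> has degree at most \<open>k\<close> in \<open>T\<close>,
  where \<open>R\<close> and the cofactor of \<open>Q\<close> only involve the variables \<open>X 1, \<dots>, X (k + 1)\<close>.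
\<close>

definition is_rem :: "nat \<Rightarrow> 'a::comm_ring_1 poly \<Rightarrow> 'a mpol poly \<Rightarrow> bool" where
  "is_rem k f R \<longleftrightarrow> R \<in> mpolys_T (k + 1) \<and> degree R \<le> k \<and>
     (\<exists>S \<in> mpolys_T (k + 1). map_poly C f - R = Q k * S)"

definition R_poly :: "nat \<Rightarrow> 'a::comm_ring_1 poly \<Rightarrow> 'a mpol poly" where
  "R_poly k f = (THE R. is_rem k f R)"

definition H_poly :: "nat \<Rightarrow> 'a::comm_ring_1 poly \<Rightarrow> 'a mpol" where
  "H_poly k f = coeff (R_poly k f) k"

definition H_mono :: "nat \<Rightarrow> nat \<Rightarrow> 'a::comm_ring_1 mpol" where
  "H_mono k j = H_poly k (monom 1 (k + j))"


subsection \<open>The remainder exists and is unique\<close>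

lemma mpolys_closed:
  fixes p q :: "'a::comm_ring_1 mpol"
  assumes "p \<in> mpolys n" "q \<in> mpolys n"
  shows "p + q \<in> mpolys n" "p - q \<in> mpolys n" "- p \<in> mpolys n" "p * q \<in> mpolys n"
proof -
  show "p + q \<in> mpolys n"
    using assms Poly_Mapping.keys_add[of p q] by (auto simp: mpolys_def)
  show "p - q \<in> mpolys n"
    using assms keys_diff[of p q] by (auto simp: mpolys_def)
  show "- p \<in> mpolys n"
    using assms by (auto simp: mpolys_def)
  show "p * q \<in> mpolys n"
    unfolding mpolys_def
  proof (intro CollectI ballI)
    fix m assume "m \<in> Poly_Mapping.keys (p * q)"
    then obtain a b where m: "m = a + b" "a \<in> Poly_Mapping.keys p" "b \<in> Poly_Mapping.keys q"
      using keys_mult[of p q] by blast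
    then have "Poly_Mapping.keys a \<subseteq> {1..n}" "Poly_Mapping.keys b \<subseteq> {1..n}"
      using assms by (auto simp: mpolys_def)
    then show "Poly_Mapping.keys m \<subseteq> {1..n}"
      unfolding m(1) using Poly_Mapping.keys_add[of a b] by blast
  qed
qed

lemma mpolys_basic: "0 \<in> mpolys n" "C a \<in> mpolys n" "1 \<in> mpolys n"
  by (auto simp: mpolys_def C_def simp flip: single_one split: if_splits)

lemma X_in_mpolys: "1 \<le> i \<Longrightarrow> i \<le> n \<Longrightarrow> X i \<in> mpolys n"
  by (auto simp: mpolys_def X_def split: if_splits)

lemma mpolys_sum: "(\<And>i. i \<in> A \<Longrightarrow> g i \<in> mpolys n) \<Longrightarrow> sum g A \<in> mpolys n"
  by (induction A rule: infinite_finite_induct) (auto simp: mpolys_basic intro: mpolys_closed)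

lemma mpolys_T_closed:
  assumes "P \<in> mpolys_T n" "P' \<in> mpolys_T n"
  shows "P + P' \<in> mpolys_T n" "P - P' \<in> mpolys_T n" "P * P' \<in> mpolys_T n"
  using assms by (auto simp: mpolys_T_def coeff_mult intro!: mpolys_closed mpolys_sum)

lemma mpolys_T_monom: "c \<in> mpolys n \<Longrightarrow> monom c i \<in> mpolys_T n"
  by (auto simp: mpolys_T_def mpolys_basic)

lemma Q_in_mpolys_T: "(Q k :: 'a::comm_ring_1 mpol poly) \<in> mpolys_T (k + 1)"
proof -
  have "(\<Prod>i\<in>A. [:- X i, 1::'a mpol:]) \<in> mpolys_T (k + 1)" if "A \<subseteq> {1..k + 1}" "finite A" for A
    using that(2,1)
  proof (induction A rule: finite_induct)
    case empty
    then show ?case by (auto simp: mpolys_T_def mpolys_basic)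
  next
    case (insert i A)
    have "[:- X i, 1::'a mpol:] \<in> mpolys_T (k + 1)"
      using insert.prems
      by (auto simp: mpolys_T_def coeff_pCons mpolys_basic intro!: mpolys_closed X_in_mpolys
               split: nat.split)
    then have "[:- X i, 1::'a mpol:] * (\<Prod>i\<in>A. [:- X i, 1::'a mpol:]) \<in> mpolys_T (k + 1)"
      using insert.prems by (intro mpolys_T_closed(3) insert.IH) auto
    then show ?case unfolding prod.insert[OF insert.hyps] .
  qed
  from this[of "{1..k + 1}"] show ?thesis unfolding Q_def by blast
qed

lemma monic_mult:
  fixes p q :: "'b::comm_ring_1 poly"
  assumes "lead_coeff p = 1" "q \<noteq> 0"
  shows "degree (p * q) = degree p + degree q" "lead_coeff (p * q) = lead_coeff q"
proof -
  have c: "coeff (p * q) (degree p + degree q) = lead_coeff q"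
    using assms by (simp add: coeff_mult_degree_sum)
  then have "degree p + degree q \<le> degree (p * q)"
    using assms by (intro le_degree) auto
  then show d: "degree (p * q) = degree p + degree q"
    using degree_mult_le[of p q] by simp
  show "lead_coeff (p * q) = lead_coeff q"
    using c d by simp
qed

lemma Q_monic:
  "degree (Q k :: 'a::comm_ring_1 mpol poly) = k + 1"
  "lead_coeff (Q k :: 'a::comm_ring_1 mpol poly) = 1"
proof -
  have "degree (\<Prod>i\<in>A. [:- X i, 1::'a mpol:]) = card A \<and> lead_coeff (\<Prod>i\<in>A. [:- X i, 1::'a mpol:]) = 1"
    if "finite A" for A
    using that
  proof (induction A rule: finite_induct)
    case (insert i A)
    let ?P = "\<Prod>i\<in>A. [:- X i, 1::'a mpol:]"
    have "?P \<noteq> 0" using insert.IH by auto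
    have lin: "degree [:- X i, 1::'a mpol:] = 1" "lead_coeff [:- X i, 1::'a mpol:] = 1"
      by auto
    note mult = monic_mult[OF lin(2) \<open>?P \<noteq> 0\<close>]
    have "degree ([:- X i, 1::'a mpol:] * ?P) = Suc (card A)"
      unfolding mult(1) lin(1) using insert.IH by linarith
    moreover have "lead_coeff ([:- X i, 1::'a mpol:] * ?P) = 1"
      unfolding mult(2) using insert.IH by (rule conjunct2)
    ultimately show ?case
      unfolding prod.insert[OF insert.hyps] card_insert_disjoint[OF insert.hyps] by (rule conjI)
  qed auto
  from this[of "{1..k + 1}"] have "degree (Q k :: 'a mpol poly) = card {1..k + 1} \<and> lead_coeff (Q k :: 'a mpol poly) = 1"
    unfolding Q_def by blast
  then show "degree (Q k :: 'a mpol poly) = k + 1" "lead_coeff (Q k :: 'a mpol poly) = 1"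
    by (simp, blast)
qed

lemma monic_division_exists:
  assumes "P \<in> mpolys_T (k + 1)"
  shows "\<exists>S \<in> mpolys_T (k + 1). \<exists>R \<in> mpolys_T (k + 1). degree R \<le> k \<and> P - R = Q k * S"
  using assms
proof (induction "degree P" arbitrary: P rule: less_induct)
  case less
  show ?case
  proof (cases "degree P \<le> k")
    case True
    then show ?thesis
      using less.prems by (intro bexI[of _ 0] bexI[of _ P]) (auto simp: mpolys_T_def mpolys_basic)
  next
    case False
    define M where "M = monom (lead_coeff P) (degree P - (k + 1))"
    define P' where "P' = P - Q k * M"
    have M: "M \<in> mpolys_T (k + 1)"
      using less.prems by (auto simp: M_def mpolys_T_def intro!: mpolys_T_monom mpolys_basic)
    have P': "P' \<in> mpolys_T (k + 1)"
      unfolding P'_def using less.prems M Q_in_mpolys_T by (auto intro: mpolys_T_closed)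
    have lc: "lead_coeff P \<noteq> 0" using False by auto
    then have "M \<noteq> 0" and dM: "degree M = degree P - (k + 1)" and lM: "lead_coeff M = lead_coeff P"
      by (auto simp: M_def degree_monom_eq)
    then have dQM: "degree (Q k * M) = degree P" "lead_coeff (Q k * M) = lead_coeff P"
      using monic_mult[OF Q_monic(2) \<open>M \<noteq> 0\<close>, of k] False by (auto simp: Q_monic)
    have "degree P' < degree P"
    proof -
      have "degree P' \<le> degree P"
        unfolding P'_def using dQM by (intro degree_diff_le) auto
      moreover have "coeff P' (degree P) = 0"
        using dQM by (simp add: P'_def)
      ultimately show ?thesis
        using False by (metis le_neq_implies_less leading_coeff_0_iff degree_0 zero_le)
    qed
    from less.hyps[OF this P'] obtain S R where
      SR: "S \<in> mpolys_T (k + 1)" "R \<in> mpolys_T (k + 1)" "degree R \<le> k" "P' - R = Q k * S"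
      by blast
    have "P - R = Q k * (S + M)"
      using SR(4) by (simp add: P'_def algebra_simps)
    then show ?thesis
      using SR M by (intro bexI[of _ "S + M"] bexI[of _ R]) (auto intro: mpolys_T_closed)
  qed
qed

lemma is_rem_ex1:
  fixes f :: "'a::comm_ring_1 poly"
  shows "\<exists>!R. is_rem k f R"
proof (rule ex_ex1I)
  have "C 0 = (0 :: 'a mpol)" by (simp add: C_def)
  then have "map_poly C f \<in> mpolys_T (k + 1)"
    by (simp add: mpolys_T_def coeff_map_poly mpolys_basic)
  from monic_division_exists[OF this] show "\<exists>R. is_rem k f R"
    by (auto simp: is_rem_def)
next
  fix R R' assume R: "is_rem k f R" and R': "is_rem k f R'"
  from R obtain S where S: "map_poly C f - R = Q k * S" "degree R \<le> k" by (auto simp: is_rem_def)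
  from R' obtain S' where S': "map_poly C f - R' = Q k * S'" "degree R' \<le> k"
    by (auto simp: is_rem_def)
  have "R - R' = (map_poly C f - R') - (map_poly C f - R)" by simp
  also have "\<dots> = Q k * (S' - S)" using S S' by (simp add: algebra_simps)
  finally have eq: "R - R' = Q k * (S' - S)" .
  have "degree (R - R') \<le> k" using S S' by (intro degree_diff_le)
  then have "S' - S = 0"
    using monic_mult(1)[OF Q_monic(2), of "S' - S" k] eq by (cases "S' - S = 0") (auto simp: Q_monic)
  then show "R = R'" using eq by simp
qed

end

theory Submission
  imports Defs
begin

text \<open>
  Reduction modulo a monic polynomial is linear over the coefficient ring: if \<open>f \<equiv> R\<close> and
  \<open>g \<equiv> R'\<close> modulo \<open>Q\<close> with \<open>R\<close> and \<open>R'\<close> of degree at most \<open>k\<close>, then \<open>f + g \<equiv> R + R'\<close> and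
  \<open>a f \<equiv> a R\<close>, the right-hand sides again have degree at most \<open>k\<close>, and uniqueness of the remainder
  (\<open>is_rem_ex1\<close>) identifies them as the remainders of \<open>f + g\<close> and \<open>a f\<close>. Extracting the
  coefficient of \<open>T^k\<close> is linear as well, so \<open>f \<mapsto> H_f\<close> is linear (\<open>H_poly_add\<close>,
  \<open>H_poly_smult\<close>, \<open>H_poly_sum\<close>).

  The asserted formula is this linearity applied to the expansion of \<open>f\<close> into monomials. Only
  \<open>f_0 T^k\<close> is not matched by some \<open>H_j\<close> with \<open>j > 0\<close>; as its degree is below
  \<open>deg Q = k + 1\<close>, it is its own remainder and contributes its coefficient \<open>f_0\<close>
  (\<open>H_mono_0\<close>).
\<close>

lemma C_hom:
  fixes a b :: "'a::comm_ring_1"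
  shows C_0: "C (0::'a) = 0" and C_1: "C (1::'a) = 1"
    and C_add: "C (a + b) = C a + C b" and C_mult: "C (a * b) = C a * C b"
  by (simp_all add: C_def single_add mult_single)

lemma map_poly_C_add:
  fixes f g :: "'a::comm_ring_1 poly"
  shows "map_poly C (f + g) = map_poly C f + map_poly C g"
  by (rule poly_eqI) (simp add: coeff_map_poly C_0 C_add)

lemma map_poly_C_smult:
  fixes f :: "'a::comm_ring_1 poly"
  shows "map_poly C (smult a f) = smult (C a) (map_poly C f)"
  by (rule poly_eqI) (simp add: coeff_map_poly C_0 C_mult)

lemma mpolys_T_smult:
  assumes "c \<in> mpolys n" "P \<in> mpolys_T n"
  shows "smult c P \<in> mpolys_T n"
  using assms by (auto simp: mpolys_T_def intro: mpolys_closed)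

lemma is_rem_add:
  assumes "is_rem k f R" "is_rem k g R'"
  shows "is_rem k (f + g) (R + R')"
proof -
  obtain S S' where S: "S \<in> mpolys_T (k + 1)" "map_poly C f - R = Q k * S"
    and S': "S' \<in> mpolys_T (k + 1)" "map_poly C g - R' = Q k * S'"
    using assms by (auto simp: is_rem_def)
  have "map_poly C (f + g) - (R + R') = (map_poly C f - R) + (map_poly C g - R')"
    by (simp add: map_poly_C_add)
  also have "\<dots> = Q k * (S + S')"
    by (simp only: S S' distrib_left)
  finally have "\<exists>U \<in> mpolys_T (k + 1). map_poly C (f + g) - (R + R') = Q k * U"
    using mpolys_T_closed(1)[OF S(1) S'(1)] by blast
  then show ?thesis
    using assms by (simp add: is_rem_def mpolys_T_closed degree_add_le)
qed

lemma is_rem_smult: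
  assumes "is_rem k f R"
  shows "is_rem k (smult a f) (smult (C a) R)"
proof -
  obtain S where S: "S \<in> mpolys_T (k + 1)" "map_poly C f - R = Q k * S"
    using assms by (auto simp: is_rem_def)
  have "map_poly C (smult a f) - smult (C a) R = smult (C a) (map_poly C f - R)"
    by (simp add: map_poly_C_smult smult_diff_right)
  also have "\<dots> = Q k * smult (C a) S"
    by (simp only: S mult_smult_right)
  finally have "\<exists>U \<in> mpolys_T (k + 1). map_poly C (smult a f) - smult (C a) R = Q k * U"
    using mpolys_T_smult[OF mpolys_basic(2) S(1)] by blast
  moreover have "degree (smult (C a) R) \<le> k"
    using assms degree_smult_le[of "C a" R] by (auto simp: is_rem_def)
  ultimately show ?thesis
    using assms by (simp add: is_rem_def mpolys_T_smult mpolys_basic)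
qed

lemma is_rem_self:
  fixes f :: "'a::comm_ring_1 poly"
  assumes "degree f \<le> k"
  shows "is_rem k f (map_poly C f)"
proof -
  have "map_poly C f \<in> mpolys_T (k + 1)"
    by (simp add: mpolys_T_def coeff_map_poly C_0 mpolys_basic)
  moreover have "degree (map_poly C f) \<le> k"
    using assms by (intro degree_le) (auto simp: coeff_map_poly C_0 coeff_eq_0)
  moreover have "(0 :: 'a mpol poly) \<in> mpolys_T (k + 1)"
    by (simp add: mpolys_T_def mpolys_basic)
  ultimately show ?thesis
    by (auto simp: is_rem_def intro!: bexI[of _ 0])
qed

lemma is_rem_R_poly: "is_rem k f (R_poly k f)"
  unfolding R_poly_def by (rule theI'[OF is_rem_ex1])

lemma R_poly_eqI: "is_rem k f R \<Longrightarrow> R_poly k f = R"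
  unfolding R_poly_def by (rule the1_equality[OF is_rem_ex1])

lemma H_poly_add: "H_poly k (f + g) = H_poly k f + H_poly k g"
  by (simp add: H_poly_def R_poly_eqI[OF is_rem_add[OF is_rem_R_poly is_rem_R_poly]])

lemma H_poly_smult: "H_poly k (smult a f) = C a * H_poly k f"
  by (simp add: H_poly_def R_poly_eqI[OF is_rem_smult[OF is_rem_R_poly]])

lemma H_poly_of_degree_le: "degree f \<le> k \<Longrightarrow> H_poly k f = C (coeff f k)"
  by (simp add: H_poly_def R_poly_eqI[OF is_rem_self] coeff_map_poly C_0)

lemma H_poly_sum: "H_poly k (\<Sum>i\<in>A. g i) = (\<Sum>i\<in>A. H_poly k (g i))"
  by (induction A rule: infinite_finite_induct)
    (simp_all add: H_poly_add H_poly_of_degree_le C_0)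

lemma H_poly_monom: "H_poly k (monom a (k + j)) = C a * H_mono k j"
  using H_poly_smult[of k a "monom 1 (k + j)"] by (simp add: H_mono_def smult_monom)

lemma H_mono_0: "H_mono k 0 = 1"
  by (simp add: H_mono_def H_poly_of_degree_le degree_monom_le C_1)

theorem proposition2p3:
  fixes f :: "'a::{field, finite} poly"
    and c :: "nat \<Rightarrow> 'a"
    and d k :: nat
  assumes "0 < d" and "0 < k" and "d < k"
    and "f = monom 1 (k + d) + (\<Sum>j<d. monom (c j) (k + j))"
  shows "H_poly k f = H_mono k d + (\<Sum>j = 1..<d. C (c j) * H_mono k j) + C (c 0)"
proof -
  have "H_poly k f = H_mono k d + (\<Sum>j<d. C (c j) * H_mono k j)"
    by (simp add: assms(4) H_poly_add H_poly_sum H_poly_monom C_1)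
  also have "(\<Sum>j<d. C (c j) * H_mono k j) =
      C (c 0) * H_mono k 0 + (\<Sum>j = 1..<d. C (c j) * H_mono k j)"
    using assms(1) by (simp add: lessThan_atLeast0 sum.atLeast_Suc_lessThan)
  finally show ?thesis
    by (simp add: H_mono_0 ac_simps)
qed

end
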